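(* Let $p=(p_{mn})_{m,n\ge 0}$ be a double sequence of nonnegative real numbers with $p_{00}>0$ such that $\sum_{k,l=0}^{m,n}p_{kl}\to\infty$ as $m,n\to\infty$ and such that $p(r,s)=\sum_{m,n=0}^{\infty}p_{mn}r^ms^n$ converges for all $r,s\in(0,1)$. Let $(L_{mn})_{m,n\ge 0}$ be a double sequence of positive linear operators from $C^*(\mathbb{R}^2)$ into $C^*(\mathbb{R}^2)$ such that, with $f_0(x,y)=1$, $$\sum_{m,n=0}^{\infty}\Vert L_{mn}(f_0)\Vert_{C^*(\mathbb{R}^2)}\,p_{mn}r^ms^n<\infty\qquad\text{for every } r,s\in(0,1).$$ Put $f_1(x,y)=\sin x$, $f_2(x,y)=\sin y$, $f_3(x,y)=\cos x$, $f_4(x,y)=\cos y$. Then $$L_{mn}(f)\to f\ (J_p)\quad\text{for all } f\in C^*(\mathbb{R}^2)$$ if and only if $$L_{mn}(f_i)\to f_i\ (J_p)\quad\text{for } i=0,1,2,3,4.$$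
   Context: $C^*(\mathbb{R}^2)$ denotes the space of continuous functions $f:\mathbb{R}^2\to\mathbb{R}$ that are $2\pi$-periodic in each variable, i.e. $f(x,y)=f(x+2k\pi,y)=f(x,y+2k\pi)$ for all $(x,y)\in\mathbb{R}^2$ and $k\in\mathbb{Z}$, with the norm $\Vert f\Vert_{C^*(\mathbb{R}^2)}=\sup_{(x,y)\in\mathbb{R}^2}|f(x,y)|$. A linear operator $L:C^*(\mathbb{R}^2)\to C^*(\mathbb{R}^2)$ is positive if $f\ge 0$ implies $L(f)\ge 0$. Convergence of double sequences and double series is in Pringsheim's sense: $a_{mn}\to a$ if for every $\varepsilon>0$ there is $N$ with $|a_{mn}-a|<\varepsilon$ whenever $m,n\ge N$; a double series converges if its rectangular partial sums $\sum_{k,l=0}^{m,n}$ converge in this sense. For functions $g_{mn},g\in C^*(\mathbb{R}^2)$, $g_{mn}\to g\ (J_p)$ (summability by the power series method determined by $p$, taken in norm) means $$\lim_{r,s\to1^-}\left\Vert\frac{1}{p(r,s)}\sum_{m,n=0}^{\infty}g_{mn}\,p_{mn}r^ms^n-g\right\Vert_{C^*(\mathbb{R}^2)}=0,$$ where $r,s\in(0,1)$ tend to $1$ jointly and independently. Under the summability hypothesis on $\Vert L_{mn}(f_0)\Vert_{C^*(\mathbb{R}^2)}$ in the claim, for each $f\in C^*(\mathbb{R}^2)$ the series $\sum_{m,n=0}^\infty L_{mn}(f;x,y)p_{mn}r^ms^n$ converges for all $r,s\in(0,1)$, where $L_{mn}(f;x,y)$ is the value of $L_{mn}(f)$ at $(x,y)$.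 *)

theory Defs
  imports "HOL-Analysis.Analysis"
begin

section \<open>Double series in the sense of Pringsheim\<close>

text \<open>The filter \<^term>\<open>sequentially \<times>\<^sub>F sequentially\<close> is the one of Pringsheim convergence: a property
  holds eventually if and only if it holds for all \<open>m, n \<ge> N\<close>, for some \<open>N\<close>.\<close>

definition rect_sum :: "(nat \<Rightarrow> nat \<Rightarrow> real) \<Rightarrow> nat \<times> nat \<Rightarrow> real" where
  "rect_sum a = (\<lambda>(m, n). \<Sum>k\<le>m. \<Sum>l\<le>n. a k l)"

definition double_sums :: "(nat \<Rightarrow> nat \<Rightarrow> real) \<Rightarrow> real \<Rightarrow> bool" where
  "double_sums a S \<longleftrightarrow> (rect_sum a \<longlongrightarrow> S) (sequentially \<times>\<^sub>F sequentially)"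

definition double_summable :: "(nat \<Rightarrow> nat \<Rightarrow> real) \<Rightarrow> bool" where
  "double_summable a \<longleftrightarrow> (\<exists>S. double_sums a S)"

definition double_suminf :: "(nat \<Rightarrow> nat \<Rightarrow> real) \<Rightarrow> real" where
  "double_suminf a = (THE S. double_sums a S)"


section \<open>The space of continuous doubly periodic functions\<close>

definition Cstar :: "(real \<times> real \<Rightarrow> real) set" where
  "Cstar = {f. continuous_on UNIV f \<and>
     (\<forall>x y. \<forall>k::int. f (x, y) = f (x + 2 * of_int k * pi, y) \<and>
                      f (x, y) = f (x, y + 2 * of_int k * pi))}"

text \<open>Meaningful for bounded functions only, in particular on \<^const>\<open>Cstar\<close>.\<close>

definition sup_norm :: "(real \<times> real \<Rightarrow> real) \<Rightarrow> real" where
  "sup_norm f = (SUP z. \<bar>f z\<bar>)"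

text \<open>Operators on \<^const>\<open>Cstar\<close> are functions on the whole function type of which only the values on
  \<^const>\<open>Cstar\<close> matter.\<close>

definition positive_linear_operator ::
  "((real \<times> real \<Rightarrow> real) \<Rightarrow> (real \<times> real \<Rightarrow> real)) \<Rightarrow> bool" where
  "positive_linear_operator L \<longleftrightarrow>
     (\<forall>f\<in>Cstar. L f \<in> Cstar) \<and>
     (\<forall>f\<in>Cstar. \<forall>g\<in>Cstar. L (\<lambda>z. f z + g z) = (\<lambda>z. L f z + L g z)) \<and>
     (\<forall>c. \<forall>f\<in>Cstar. L (\<lambda>z. c * f z) = (\<lambda>z. c * L f z)) \<and>
     (\<forall>f\<in>Cstar. (\<forall>z. 0 \<le> f z) \<longrightarrow> (\<forall>z. 0 \<le> L f z))"


section \<open>Power series methods\<close>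

definition p_fun :: "(nat \<Rightarrow> nat \<Rightarrow> real) \<Rightarrow> real \<Rightarrow> real \<Rightarrow> real" where
  "p_fun p r s = double_suminf (\<lambda>m n. p m n * r ^ m * s ^ n)"

definition Jp_mean ::
  "(nat \<Rightarrow> nat \<Rightarrow> real) \<Rightarrow> (nat \<Rightarrow> nat \<Rightarrow> real \<times> real \<Rightarrow> real) \<Rightarrow>
    real \<Rightarrow> real \<Rightarrow> real \<times> real \<Rightarrow> real" where
  "Jp_mean p g r s =
     (\<lambda>z. 1 / p_fun p r s * double_suminf (\<lambda>m n. g m n z * p m n * r ^ m * s ^ n))"

text \<open>The first two conjuncts say that the norm in the limit makes sense: the series converge, and the
  means are elements of \<^const>\<open>Cstar\<close>. They exclude accidental values of
  \<^const>\<open>double_suminf\<close> and \<^const>\<open>sup_norm\<close>.\<close>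

definition Jp_converges ::
  "(nat \<Rightarrow> nat \<Rightarrow> real) \<Rightarrow> (nat \<Rightarrow> nat \<Rightarrow> real \<times> real \<Rightarrow> real) \<Rightarrow>
    (real \<times> real \<Rightarrow> real) \<Rightarrow> bool" where
  "Jp_converges p g h \<longleftrightarrow>
     (\<forall>r\<in>{0<..<1}. \<forall>s\<in>{0<..<1}. \<forall>z. double_summable (\<lambda>m n. g m n z * p m n * r ^ m * s ^ n)) \<and>
     (\<forall>r\<in>{0<..<1}. \<forall>s\<in>{0<..<1}. Jp_mean p g r s \<in> Cstar) \<and>
     ((\<lambda>(r, s). sup_norm (\<lambda>z. Jp_mean p g r s z - h z)) \<longlongrightarrow> 0) (at_left 1 \<times>\<^sub>F at_left 1)"

end

theory Submission
  imports Defs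
begin

text \<open>For fixed \<open>r\<close> and \<open>s\<close> the power series mean of the operators is itself a positive linear
  operator \<open>T\<close> on \<^const>\<open>Cstar\<close>; that \<open>T f\<close> is continuous is the Weierstrass M-test for Pringsheim
  convergence. So the claim reduces to a Korovkin estimate that is uniform in \<open>T\<close>. By uniform
  continuity and periodicity, \<open>\<bar>f (u, v) - f (x, y)\<bar> \<le> e + K * (2 - cos (u - x) - cos (v - y))\<close>. Apply
  \<open>T\<close> in \<open>(u, v)\<close> and evaluate at \<open>(x, y)\<close>: by the addition theorem the kernel is a combination of the
  five test functions, and it vanishes at \<open>(x, y)\<close>, so its image there is bounded by the errors of \<open>T\<close>
  on the test functions.\<close>

section \<open>Double series\<close>

lemma prod_sequentially_nontrivial: "sequentially \<times>\<^sub>F sequentially \<noteq> bot"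
  by (simp add: prod_filter_eq_bot)

lemma rect_sum_eq_sum: "rect_sum a (m, n) = (\<Sum>(k, l)\<in>{..m} \<times> {..n}. a k l)"
  by (simp add: rect_sum_def sum.cartesian_product)

lemma rect_sum_add: "rect_sum (\<lambda>m n. a m n + b m n) = (\<lambda>q. rect_sum a q + rect_sum b q)"
  by (auto simp: rect_sum_def sum.distrib)

lemma rect_sum_cmult: "rect_sum (\<lambda>m n. c * a m n) = (\<lambda>q. c * rect_sum a q)"
  by (auto simp: rect_sum_def sum_distrib_left)

lemma rect_sum_mono: "(\<And>m n. a m n \<le> b m n) \<Longrightarrow> rect_sum a q \<le> rect_sum b q"
  by (cases q) (auto simp: rect_sum_def intro!: sum_mono)

lemma rect_sum_mono_index:
  assumes "\<And>m n. 0 \<le> a m n" "m \<le> m'" "n \<le> n'"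
  shows "rect_sum a (m, n) \<le> rect_sum a (m', n')"
  unfolding rect_sum_eq_sum using assms by (intro sum_mono2) auto

lemma eventually_rect_sum_ge:
  assumes "\<And>m n. 0 \<le> a m n"
  shows "\<forall>\<^sub>F q in sequentially \<times>\<^sub>F sequentially. rect_sum a (m, n) \<le> rect_sum a q"
proof -
  have "\<forall>\<^sub>F q in sequentially \<times>\<^sub>F sequentially. m \<le> fst q \<and> n \<le> snd q"
    by (intro eventually_prodI eventually_ge_at_top)
  then show ?thesis
    by eventually_elim (use rect_sum_mono_index[OF assms] in \<open>force simp: split_beta\<close>)
qed

lemma rect_sum_le_double_sums:
  assumes "\<And>m n. 0 \<le> a m n" "double_sums a S"
  shows "rect_sum a q \<le> S"
  using tendsto_lowerbound[OF assms(2)[unfolded double_sums_def] eventually_rect_sum_ge[OF assms(1)]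
      prod_sequentially_nontrivial, of "fst q" "snd q"] by simp

section \<open>Uniqueness and linearity of Pringsheim sums\<close>

lemma double_sums_unique: "double_sums a S \<Longrightarrow> double_sums a T \<Longrightarrow> S = T"
  unfolding double_sums_def using tendsto_unique[OF prod_sequentially_nontrivial] by blast

lemma double_suminf_eqI: "double_sums a S \<Longrightarrow> double_suminf a = S"
  unfolding double_suminf_def by (blast intro: double_sums_unique)

lemma double_summable_sums: "double_summable a \<Longrightarrow> double_sums a (double_suminf a)"
  using double_suminf_eqI by (auto simp: double_summable_def)

lemma double_sums_add:
  "double_sums a S \<Longrightarrow> double_sums b T \<Longrightarrow> double_sums (\<lambda>m n. a m n + b m n) (S + T)"
  unfolding double_sums_def rect_sum_add by (rule tendsto_add)

lemma double_sums_cmult: "double_sums a S \<Longrightarrow> double_sums (\<lambda>m n. c * a m n) (c * S)"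
  unfolding double_sums_def rect_sum_cmult by (rule tendsto_mult_left)

lemma double_sums_nonneg: "(\<And>m n. 0 \<le> a m n) \<Longrightarrow> double_sums a S \<Longrightarrow> 0 \<le> S"
  using rect_sum_le_double_sums[of a S "(0, 0)"] by (auto simp: rect_sum_def intro: order_trans)

text \<open>Rectangular sums of nonnegative terms grow with the rectangle, so they converge to their
  supremum: a level below it is exceeded by one rectangle and hence by all larger ones.\<close>

lemma double_summable_bounded:
  assumes nonneg: "\<And>m n. 0 \<le> a m n" and bound: "\<And>q. rect_sum a q \<le> B"
  shows "double_summable a"
proof -
  have bdd: "bdd_above (range (rect_sum a))"
    using bound by (intro bdd_aboveI2)
  have "(rect_sum a \<longlongrightarrow> (SUP q. rect_sum a q)) (sequentially \<times>\<^sub>F sequentially)"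
  proof (rule order_tendstoI)
    fix x assume "x < (SUP q. rect_sum a q)"
    then obtain m n where x: "x < rect_sum a (m, n)"
      using bdd by (auto simp: less_cSUP_iff)
    show "\<forall>\<^sub>F q in sequentially \<times>\<^sub>F sequentially. x < rect_sum a q"
      using eventually_rect_sum_ge[of a m n, OF nonneg] by eventually_elim (use x in linarith)
  next
    fix x assume "(SUP q. rect_sum a q) < x"
    then show "\<forall>\<^sub>F q in sequentially \<times>\<^sub>F sequentially. rect_sum a q < x"
      by (intro always_eventually allI) (meson UNIV_I bdd cSUP_upper le_less_trans)
  qed
  then show ?thesis
    by (auto simp: double_summable_def double_sums_def)
qed

text \<open>Boundedness of the rectangular sums settles nonnegative terms only, so the argument
  passes to \<open>a + b\<close>, which lies between 0 and \<open>2 * b\<close>. Subtracting the sum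
  of \<open>b\<close> then recovers \<open>a\<close>.\<close>

lemma double_summable_comparison:
  assumes dom: "\<And>m n. \<bar>a m n\<bar> \<le> b m n" and b: "double_summable b"
  shows "double_summable a"
proof -
  from b obtain B where B: "double_sums b B"
    by (auto simp: double_summable_def)
  have ab: "0 \<le> a m n + b m n" "a m n + b m n \<le> 2 * b m n" "0 \<le> b m n" for m n
    using dom[of m n] by linarith+
  have "rect_sum (\<lambda>m n. a m n + b m n) q \<le> 2 * B" for q
  proof -
    have "rect_sum (\<lambda>m n. a m n + b m n) q \<le> 2 * rect_sum b q"
      using rect_sum_mono[of "\<lambda>m n. a m n + b m n" "\<lambda>m n. 2 * b m n", OF ab(2)]
      by (simp add: rect_sum_cmult)
    also have "\<dots> \<le> 2 * B"
      using rect_sum_le_double_sums[OF ab(3) B] by simp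
    finally show ?thesis .
  qed
  then have "double_summable (\<lambda>m n. a m n + b m n)"
    by (intro double_summable_bounded ab(1))
  then obtain A where "double_sums (\<lambda>m n. a m n + b m n) A"
    unfolding double_summable_def by blast
  from double_sums_add[OF this double_sums_cmult[OF B, of "-1"]] show ?thesis
    by (auto simp: double_summable_def)
qed

text \<open>The terms of \<open>b + a\<close> and \<open>b - a\<close> are nonnegative, so their
  rectangular sums stay below \<open>B + A\<close> and \<open>B - A\<close>. Rearranged, these are
  the two halves of the estimate, whose right side depends on \<open>a\<close> no longer.\<close>

lemma double_sums_tail_bound:
  assumes dom: "\<And>m n. \<bar>a m n\<bar> \<le> b m n" and A: "double_sums a A" and B: "double_sums b B"
  shows "\<bar>rect_sum a q - A\<bar> \<le> B - rect_sum b q"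
proof -
  have "0 \<le> b m n + a m n" "0 \<le> b m n + - 1 * a m n" for m n
    using dom[of m n] by auto
  note rect_sum_le_double_sums[OF this(1) double_sums_add[OF B A], of q]
    rect_sum_le_double_sums[OF this(2) double_sums_add[OF B double_sums_cmult[OF A, of "-1"]], of q]
  then show ?thesis
    unfolding rect_sum_add rect_sum_cmult by linarith
qed

text \<open>Weierstrass M-test: the tail bound involves only the majorant \<open>b\<close> and is
  therefore the same for all \<open>z\<close>.\<close>

lemma uniform_limit_rect_sum:
  fixes a :: "nat \<Rightarrow> nat \<Rightarrow> 'a \<Rightarrow> real"
  assumes dom: "\<And>m n z. \<bar>a m n z\<bar> \<le> b m n" and b: "double_summable b"
  shows "uniform_limit UNIV (\<lambda>q z. rect_sum (\<lambda>m n. a m n z) q)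
    (\<lambda>z. double_suminf (\<lambda>m n. a m n z)) (sequentially \<times>\<^sub>F sequentially)"
proof (rule uniform_limitI)
  fix e :: real assume "0 < e"
  let ?B = "double_suminf b"
  have B: "double_sums b ?B"
    using b by (rule double_summable_sums)
  have A: "double_sums (\<lambda>m n. a m n z) (double_suminf (\<lambda>m n. a m n z))" for z
    using double_summable_comparison[OF dom b] by (rule double_summable_sums)
  have "\<forall>\<^sub>F q in sequentially \<times>\<^sub>F sequentially. ?B - e < rect_sum b q"
    using B \<open>0 < e\<close> unfolding double_sums_def by (intro order_tendstoD) auto
  then show "\<forall>\<^sub>F q in sequentially \<times>\<^sub>F sequentially. \<forall>z\<in>UNIV.
    dist (rect_sum (\<lambda>m n. a m n z) q) (double_suminf (\<lambda>m n. a m n z)) < e"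
  proof eventually_elim
    case (elim q)
    have "\<bar>rect_sum (\<lambda>m n. a m n z) q - double_suminf (\<lambda>m n. a m n z)\<bar> < e" for z
      using double_sums_tail_bound[OF dom A B, of z q] elim by linarith
    then show ?case
      by (simp add: dist_real_def)
  qed
qed


section \<open>Periodic functions and positive operators\<close>

lemma Cstar_continuous: "f \<in> Cstar \<Longrightarrow> continuous_on UNIV f"
  by (simp add: Cstar_def)

lemma Cstar_periodic:
  assumes "f \<in> Cstar"
  shows "f (x + 2 * of_int k * pi, y + 2 * of_int l * pi) = f (x, y)"
  using assms unfolding Cstar_def mem_Collect_eq by metis

lemma Cstar_add: "f \<in> Cstar \<Longrightarrow> g \<in> Cstar \<Longrightarrow> (\<lambda>z. f z + g z) \<in> Cstar"
  unfolding Cstar_def mem_Collect_eq by (metis continuous_on_add)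

lemma Cstar_cmult: "f \<in> Cstar \<Longrightarrow> (\<lambda>z. c * f z) \<in> Cstar"
  unfolding Cstar_def mem_Collect_eq by (metis continuous_on_mult_left)

lemma Cstar_const: "(\<lambda>z. c) \<in> Cstar"
  by (simp add: Cstar_def)

lemma sin_cos_periodic_int:
  "sin (x + 2 * of_int k * pi) = sin x" "cos (x + 2 * of_int k * pi) = cos x"
  using sin.plus_of_int[of x k] cos.plus_of_int[of x k] by (simp_all add: mult_ac)

lemma Cstar_trig:
  "(\<lambda>z. sin (fst z)) \<in> Cstar" "(\<lambda>z. sin (snd z)) \<in> Cstar"
  "(\<lambda>z. cos (fst z)) \<in> Cstar" "(\<lambda>z. cos (snd z)) \<in> Cstar"
  by (auto simp: Cstar_def sin_cos_periodic_int intro!: continuous_intros)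

text \<open>One shift by periods, fixed by the point \<open>(x, y)\<close>, is valid for all
  \<open>(u, v)\<close>. This allows a nearby second point to be moved along with
  \<open>(x, y)\<close> without changing their distance.\<close>

lemma Cstar_reduce:
  assumes "f \<in> Cstar"
  obtains k l :: int where "x - 2 * of_int k * pi \<in> {0..2 * pi}" "y - 2 * of_int l * pi \<in> {0..2 * pi}"
    "\<And>u v. f (u - 2 * of_int k * pi, v - 2 * of_int l * pi) = f (u, v)"
proof -
  have reduce: "x - 2 * of_int \<lfloor>x / (2 * pi)\<rfloor> * pi \<in> {0..2 * pi}" for x
  proof -
    have "of_int \<lfloor>x / (2 * pi)\<rfloor> * (2 * pi) \<le> x" "x < (of_int \<lfloor>x / (2 * pi)\<rfloor> + 1) * (2 * pi)"
      using floor_divide_lower[of "2 * pi" x] floor_divide_upper[of "2 * pi" x] by simp_all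
    then show ?thesis
      by (simp add: algebra_simps)
  qed
  show thesis
    using Cstar_periodic[OF assms, of _ "- \<lfloor>x / (2 * pi)\<rfloor>" _ "- \<lfloor>y / (2 * pi)\<rfloor>"]
    by (intro that[OF reduce reduce]) simp
qed

lemma Cstar_bounded:
  assumes "f \<in> Cstar"
  obtains M where "\<And>z. \<bar>f z\<bar> \<le> M"
proof -
  have "bounded (f ` ({0..2 * pi} \<times> {0..2 * pi}))"
    using Cstar_continuous[OF assms]
    by (intro compact_imp_bounded compact_continuous_image compact_Times)
      (auto intro: continuous_on_subset)
  then obtain M where M: "\<And>z. z \<in> {0..2 * pi} \<times> {0..2 * pi} \<Longrightarrow> \<bar>f z\<bar> \<le> M"
    by (auto simp: bounded_iff)
  have "\<bar>f (x, y)\<bar> \<le> M" for x y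
  proof -
    obtain k l :: int where "x - 2 * of_int k * pi \<in> {0..2 * pi}" "y - 2 * of_int l * pi \<in> {0..2 * pi}"
      "f (x - 2 * of_int k * pi, y - 2 * of_int l * pi) = f (x, y)"
      using Cstar_reduce[OF assms, of x y] by metis
    then show ?thesis
      using M[of "(x - 2 * of_int k * pi, y - 2 * of_int l * pi)"] by simp
  qed
  then show thesis
    using that by auto
qed

section \<open>The supremum norm on \<open>Cstar\<close>\<close>

lemma abs_le_sup_norm:
  assumes "f \<in> Cstar"
  shows "\<bar>f z\<bar> \<le> sup_norm f"
proof -
  obtain M where "\<And>z. \<bar>f z\<bar> \<le> M"
    using Cstar_bounded[OF assms] by blast
  then show ?thesis
    unfolding sup_norm_def by (intro cSUP_upper bdd_aboveI2) auto
qed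

lemma sup_norm_le: "(\<And>z. \<bar>f z\<bar> \<le> B) \<Longrightarrow> sup_norm f \<le> B"
  unfolding sup_norm_def by (intro cSUP_least) auto

lemma sup_norm_nonneg: "f \<in> Cstar \<Longrightarrow> 0 \<le> sup_norm f"
  by (rule order_trans[OF abs_ge_zero abs_le_sup_norm])

lemma Cstar_diff: "f \<in> Cstar \<Longrightarrow> g \<in> Cstar \<Longrightarrow> (\<lambda>z. f z - g z) \<in> Cstar"
  using Cstar_add[of f "\<lambda>z. - 1 * g z"] Cstar_cmult[of g "- 1"] by simp

section \<open>Order properties of positive linear operators\<close>

lemma
  assumes "positive_linear_operator T"
  shows plo_Cstar: "f \<in> Cstar \<Longrightarrow> T f \<in> Cstar"
    and plo_add: "f \<in> Cstar \<Longrightarrow> g \<in> Cstar \<Longrightarrow> T (\<lambda>z. f z + g z) z = T f z + T g z"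
    and plo_cmult: "f \<in> Cstar \<Longrightarrow> T (\<lambda>z. c * f z) z = c * T f z"
    and plo_nonneg: "f \<in> Cstar \<Longrightarrow> (\<And>z. 0 \<le> f z) \<Longrightarrow> 0 \<le> T f z"
  using assms unfolding positive_linear_operator_def by (simp_all del: split_paired_All)

lemma plo_diff:
  assumes "positive_linear_operator T" "f \<in> Cstar" "g \<in> Cstar"
  shows "T (\<lambda>z. f z - g z) z = T f z - T g z"
  using plo_add[OF assms(1,2) Cstar_cmult[OF assms(3)], of "- 1" z] plo_cmult[OF assms(1,3), of "- 1" z]
  by simp

lemma plo_mono:
  assumes "positive_linear_operator T" "f \<in> Cstar" "g \<in> Cstar" "\<And>z. f z \<le> g z"
  shows "T f z \<le> T g z"
  using plo_nonneg[OF assms(1) Cstar_diff[OF assms(3,2)], of z] plo_diff[OF assms(1,3,2), of z] assms(4)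
  by simp

lemma plo_abs_le:
  assumes "positive_linear_operator T" "f \<in> Cstar" "g \<in> Cstar" "\<And>z. \<bar>f z\<bar> \<le> g z"
  shows "\<bar>T f z\<bar> \<le> T g z"
proof -
  have "f w \<le> g w" "- 1 * f w \<le> g w" for w
    using assms(4)[of w] by linarith+
  then have "T f z \<le> T g z" "T (\<lambda>z. - 1 * f z) z \<le> T g z"
    using plo_mono[OF assms(1) _ assms(3)] assms(2) Cstar_cmult[OF assms(2)] by blast+
  then show ?thesis
    using plo_cmult[OF assms(1,2), of "- 1" z] by linarith
qed


section \<open>A quantitative Korovkin theorem\<close>

text \<open>Taking for \<open>k\<close> the integer nearest to \<open>t / (2 * pi)\<close> leaves a
  remainder in [-pi, pi], where the cosine decreases with the absolute value. A remainder of size at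
  least \<open>d\<close> would thus give \<open>cos t <= cos d\<close>.\<close>

lemma cos_near_one:
  assumes "0 < d" "d \<le> pi" "1 - cos t < 1 - cos d"
  obtains k :: int where "\<bar>t - 2 * of_int k * pi\<bar> < d"
proof -
  define k where "k = round (t / (2 * pi))"
  define u where "u = t - 2 * of_int k * pi"
  have "\<bar>of_int k - t / (2 * pi)\<bar> \<le> 1 / 2"
    unfolding k_def by (rule of_int_round_abs_le)
  then have u: "\<bar>u\<bar> \<le> pi"
    by (simp add: u_def abs_le_iff field_simps)
  have "cos \<bar>u\<bar> = cos t"
    using sin_cos_periodic_int(2)[of u k] by (simp add: u_def)
  then have "\<bar>u\<bar> < d"
    using cos_monotone_0_pi_le[of d "\<bar>u\<bar>"] assms u by linarith
  then show thesis
    using that[of k] by (simp add: u_def)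
qed

lemma Cstar_modulus:
  assumes f: "f \<in> Cstar" and e: "0 < e"
  obtains d where "0 < d" "d \<le> pi"
    "\<And>x y u v. \<bar>u - x\<bar> < d \<Longrightarrow> \<bar>v - y\<bar> < d \<Longrightarrow> \<bar>f (u, v) - f (x, y)\<bar> < e"
proof -
  \<comment> \<open>The period square enlarged by pi on each side: a point whose coordinates differ
    by less than pi from those of a point in [0, 2 pi]^2 still lies in it.\<close>
  let ?K = "{- pi..3 * pi} \<times> {- pi..3 * pi}"
  have "uniformly_continuous_on ?K f"
    using Cstar_continuous[OF f]
    by (intro compact_uniformly_continuous compact_Times) (auto intro: continuous_on_subset)
  then obtain d where d: "0 < d"
    "\<And>z w. z \<in> ?K \<Longrightarrow> w \<in> ?K \<Longrightarrow> dist w z < d \<Longrightarrow> dist (f w) (f z) < e"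
    using e unfolding uniformly_continuous_on_def by metis
  show thesis
  proof (rule that)
    \<comment> \<open>\<open>d / 2\<close> in each coordinate keeps the distance in the plane below
      \<open>d\<close>; the bound pi keeps the second point inside \<open>?K\<close>.\<close>
    show "0 < min (d / 2) pi" "min (d / 2) pi \<le> pi"
      using d(1) by auto
    fix x y u v :: real
    assume near: "\<bar>u - x\<bar> < min (d / 2) pi" "\<bar>v - y\<bar> < min (d / 2) pi"
    obtain k l :: int where kl: "x - 2 * of_int k * pi \<in> {0..2 * pi}" "y - 2 * of_int l * pi \<in> {0..2 * pi}"
      and per: "\<And>u v. f (u - 2 * of_int k * pi, v - 2 * of_int l * pi) = f (u, v)"
      using Cstar_reduce[OF f, of x y] by metis
    let ?z = "(x - 2 * of_int k * pi, y - 2 * of_int l * pi)"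
    let ?w = "(u - 2 * of_int k * pi, v - 2 * of_int l * pi)"
    have "dist ?w ?z \<le> \<bar>u - x\<bar> + \<bar>v - y\<bar>"
      using sqrt_sum_squares_le_sum_abs[of "u - x" "v - y"] by (simp add: dist_Pair_Pair dist_real_def)
    then have "dist ?w ?z < d"
      using near by linarith
    moreover have "?z \<in> ?K" "?w \<in> ?K"
      using kl near by (auto simp: abs_less_iff min_less_iff_conj)
    ultimately have "dist (f ?w) (f ?z) < e"
      using d(2) by blast
    then show "\<bar>f (u, v) - f (x, y)\<bar> < e"
      by (simp add: per dist_real_def)
  qed
qed

text \<open>The kernel controls the distance modulo periods. Where it is below
  \<open>h = 1 - cos d\<close>, the points are close modulo periods and \<open>e\<close> alone
  suffices. Elsewhere it is at least \<open>h\<close>, and the factor \<open>2 * M / h\<close> lifts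
  it above the trivial bound \<open>2 * M\<close>.\<close>

lemma Cstar_korovkin_modulus:
  assumes f: "f \<in> Cstar" and e: "0 < e"
  obtains K where "0 \<le> K"
    "\<And>x y u v. \<bar>f (u, v) - f (x, y)\<bar> \<le> e + K * (2 - cos (u - x) - cos (v - y))"
proof -
  obtain M where M: "\<And>z. \<bar>f z\<bar> \<le> M"
    using Cstar_bounded[OF f] by blast
  then have "0 \<le> M"
    using order_trans[OF abs_ge_zero] by blast
  obtain d where d: "0 < d" "d \<le> pi"
    and mod: "\<And>x y u v. \<bar>u - x\<bar> < d \<Longrightarrow> \<bar>v - y\<bar> < d \<Longrightarrow> \<bar>f (u, v) - f (x, y)\<bar> < e"
    using Cstar_modulus[OF f e] by blast
  define h where "h = 1 - cos d"
  have h: "0 < h"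
    using cos_monotone_0_pi[of 0 d] d by (simp add: h_def)
  show thesis
  proof (rule that)
    show K: "0 \<le> 2 * M / h"
      using h \<open>0 \<le> M\<close> by simp
    fix x y u v :: real
    let ?q = "2 - cos (u - x) - cos (v - y)"
    have cos: "cos (u - x) \<le> 1" "cos (v - y) \<le> 1"
      by simp_all
    show "\<bar>f (u, v) - f (x, y)\<bar> \<le> e + 2 * M / h * ?q"
    proof (cases "?q < h")
      case True
      \<comment> \<open>Both differences are nonnegative and \<open>?q\<close> is their sum, so each
        is at most \<open>?q\<close>.\<close>
      then have "1 - cos (u - x) < h" "1 - cos (v - y) < h"
        using cos by linarith+
      then obtain k l :: int where "\<bar>u - x - 2 * of_int k * pi\<bar> < d" "\<bar>v - y - 2 * of_int l * pi\<bar> < d"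
        using cos_near_one[OF d] unfolding h_def by metis
      then have "\<bar>f (u, v) - f (x + 2 * of_int k * pi, y + 2 * of_int l * pi)\<bar> < e"
        by (intro mod) (simp_all add: algebra_simps)
      moreover have "0 \<le> 2 * M / h * ?q"
        using K cos by (intro mult_nonneg_nonneg) linarith+
      ultimately show ?thesis
        by (simp add: Cstar_periodic[OF f])
    next
      case False
      then have "2 * M / h * h \<le> 2 * M / h * ?q"
        using K by (intro mult_left_mono) auto
      moreover have "\<bar>f (u, v) - f (x, y)\<bar> \<le> 2 * M"
        using M[of "(u, v)"] M[of "(x, y)"] by linarith
      ultimately show ?thesis
        using h e by simp
    qed
  qed
qed

text \<open>A sum rather than a maximum: the five limits simply add up, and each norm is still
  bounded by the total, since norms of elements of \<open>Cstar\<close> are nonnegative.\<close>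

definition korovkin_error :: "((real \<times> real \<Rightarrow> real) \<Rightarrow> real \<times> real \<Rightarrow> real) \<Rightarrow> real" where
  "korovkin_error T =
     sup_norm (\<lambda>z. T (\<lambda>z. 1) z - 1) +
     sup_norm (\<lambda>z. T (\<lambda>z. sin (fst z)) z - sin (fst z)) +
     sup_norm (\<lambda>z. T (\<lambda>z. sin (snd z)) z - sin (snd z)) +
     sup_norm (\<lambda>z. T (\<lambda>z. cos (fst z)) z - cos (fst z)) +
     sup_norm (\<lambda>z. T (\<lambda>z. cos (snd z)) z - cos (snd z))"

lemma korovkin_kernel_bound:
  assumes T: "positive_linear_operator T"
  defines "q \<equiv> \<lambda>x y z. 2 - cos (fst z - x) - cos (snd z - y)"
  shows "q x y \<in> Cstar" "T (q x y) (x, y) \<le> 2 * korovkin_error T"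
proof -
  \<comment> \<open>Expansion of the kernel by the addition theorem. The constant is written
    \<open>2 * 1\<close> so that it too is a multiple of a test function.\<close>
  let ?g = "\<lambda>z. 2 * 1 - cos x * cos (fst z) - sin x * sin (fst z) - cos y * cos (snd z) - sin y * sin (snd z)"
  have q: "q x y = ?g"
    by (auto simp: q_def cos_diff algebra_simps)
  \<comment> \<open>\<open>C(3)\<close> to \<open>C(7)\<close> are the memberships of sin x, sin y,
    cos x, cos y and 1, in this order.\<close>
  note C = Cstar_diff Cstar_cmult Cstar_trig Cstar_const[of 1]
  show "q x y \<in> Cstar"
    unfolding q by (intro C)
  have scale: "a * (b - c) \<le> E" if "\<bar>a\<bar> \<le> 1" "\<bar>c - b\<bar> \<le> E" for a b c E :: real
  proof -
    have "a * (b - c) \<le> \<bar>a\<bar> * \<bar>c - b\<bar>"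
      by (metis abs_ge_self abs_minus_commute abs_mult)
    also have "\<dots> \<le> 1 * E"
      using that by (intro mult_mono) auto
    finally show ?thesis by simp
  qed
  have err: "\<bar>T f z - f z\<bar> \<le> sup_norm (\<lambda>z. T f z - f z)" if "f \<in> Cstar" for f z
    using abs_le_sup_norm[OF Cstar_diff[OF plo_Cstar[OF T that] that], of z] .
  have sq: "sin t * sin t = 1 - cos t * cos t" for t :: real
    using sin_cos_squared_add[of t] by (simp add: power2_eq_square)
  let ?z = "(x, y)"
  have "T (q x y) ?z = 2 * T (\<lambda>z. 1) ?z - cos x * T (\<lambda>z. cos (fst z)) ?z - sin x * T (\<lambda>z. sin (fst z)) ?z
      - cos y * T (\<lambda>z. cos (snd z)) ?z - sin y * T (\<lambda>z. sin (snd z)) ?z"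
    unfolding q
    by ((subst plo_diff[OF T], (intro C)+)+, (subst plo_cmult[OF T], (intro C)+)+, rule refl)
  \<comment> \<open>The 2 subtracted in the first summand reappears as the squares of sine and
    cosine of \<open>x\<close> and of \<open>y\<close>. Each summand is now an error on a test
    function at \<open>(x, y)\<close>, times 2 or a coefficient of modulus at most 1.\<close>
  also have "\<dots> = 2 * (T (\<lambda>z. 1) ?z - 1) + cos x * (cos x - T (\<lambda>z. cos (fst z)) ?z)
      + sin x * (sin x - T (\<lambda>z. sin (fst z)) ?z) + cos y * (cos y - T (\<lambda>z. cos (snd z)) ?z)
      + sin y * (sin y - T (\<lambda>z. sin (snd z)) ?z)"
    by (simp add: algebra_simps sq)
  also have "\<dots> \<le> 2 * sup_norm (\<lambda>z. T (\<lambda>z. 1) z - 1)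
      + sup_norm (\<lambda>z. T (\<lambda>z. cos (fst z)) z - cos (fst z))
      + sup_norm (\<lambda>z. T (\<lambda>z. sin (fst z)) z - sin (fst z))
      + sup_norm (\<lambda>z. T (\<lambda>z. cos (snd z)) z - cos (snd z))
      + sup_norm (\<lambda>z. T (\<lambda>z. sin (snd z)) z - sin (snd z))"
    using mult_left_mono[OF abs_le_D1[OF err[OF C(7), of ?z]], of 2] scale[OF abs_sin_le_one err[OF C(3), of ?z], of x]
      scale[OF abs_sin_le_one err[OF C(4), of ?z], of y] scale[OF abs_cos_le_one err[OF C(5), of ?z], of x]
      scale[OF abs_cos_le_one err[OF C(6), of ?z], of y]
    unfolding fst_conv snd_conv by (intro add_mono) simp_all
  also have "\<dots> \<le> 2 * korovkin_error T"
    using plo_Cstar[OF T] C(3-7) by (simp add: korovkin_error_def sup_norm_nonneg Cstar_diff)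
  finally show "T (q x y) (x, y) \<le> 2 * korovkin_error T" .
qed

text \<open>\<open>K\<close> is chosen before \<open>T\<close>, so one constant serves a whole
  family of operators; it depends on \<open>f\<close> and \<open>e\<close> only.\<close>

lemma korovkin_quantitative:
  assumes f: "f \<in> Cstar" and e: "0 < e"
  obtains K where
    "\<And>T. positive_linear_operator T \<Longrightarrow> sup_norm (\<lambda>z. T f z - f z) \<le> e + K * korovkin_error T"
proof -
  obtain K where "0 \<le> K"
    and K: "\<And>x y u v. \<bar>f (u, v) - f (x, y)\<bar> \<le> e + K * (2 - cos (u - x) - cos (v - y))"
    using Cstar_korovkin_modulus[OF f e] by blast
  obtain M where M: "\<And>z. \<bar>f z\<bar> \<le> M"
    using Cstar_bounded[OF f] by blast
  \<comment> \<open>In the factor, \<open>e\<close> comes from the error of \<open>T\<close> on the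
    constant \<open>e\<close>, \<open>2 * K\<close> from the kernel bound, and \<open>M\<close> from
    the error of \<open>T\<close> on the constant \<open>f z\<close>.\<close>
  have "sup_norm (\<lambda>z. T f z - f z) \<le> e + (e + 2 * K + M) * korovkin_error T"
    if T: "positive_linear_operator T" for T
  proof (rule sup_norm_le)
    fix z :: "real \<times> real"
    obtain x y where z: "z = (x, y)"
      by (cases z)
    define q :: "real \<times> real \<Rightarrow> real" where "q = (\<lambda>w. 2 - cos (fst w - x) - cos (snd w - y))"
    have q: "q \<in> Cstar" "T q z \<le> 2 * korovkin_error T"
      using korovkin_kernel_bound[OF T, of x y] unfolding q_def z by blast+
    note C = f q(1) Cstar_const Cstar_cmult Cstar_add Cstar_diff
    have err0: "\<bar>T (\<lambda>z. 1) z - 1\<bar> \<le> korovkin_error T"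
    proof -
      have "\<bar>T (\<lambda>z. 1) z - 1\<bar> \<le> sup_norm (\<lambda>z. T (\<lambda>z. 1) z - 1)"
        by (intro abs_le_sup_norm Cstar_diff plo_Cstar[OF T] Cstar_const)
      also have "\<dots> \<le> korovkin_error T"
        using plo_Cstar[OF T] Cstar_trig by (simp add: korovkin_error_def sup_norm_nonneg Cstar_diff)
      finally show ?thesis .
    qed
    \<comment> \<open>\<open>T\<close> need not preserve constants, so \<open>T f z\<close> is first
      compared with the image of the constant \<open>f z\<close>; the difference of that image from
      \<open>f z\<close> is estimated separately.\<close>
    have "T f z - f z * T (\<lambda>z. 1) z = T (\<lambda>w. f w - f z * 1) z"
      using plo_diff[OF T f Cstar_cmult[OF Cstar_const], of "f z" 1 z]
        plo_cmult[OF T Cstar_const, of "f z" 1 z] by simp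
    also have "\<bar>\<dots>\<bar> \<le> T (\<lambda>w. e * 1 + K * q w) z"
      using K[of _ _ x y] by (intro plo_abs_le[OF T] C) (auto simp: z q_def)
    also have "\<dots> = e * T (\<lambda>z. 1) z + K * T q z"
      using plo_add[OF T Cstar_cmult[OF Cstar_const] Cstar_cmult[OF q(1)], of e 1 K z]
        plo_cmult[OF T Cstar_const, of e 1 z] plo_cmult[OF T q(1), of K z] by simp
    also have "\<dots> \<le> e * (1 + korovkin_error T) + K * (2 * korovkin_error T)"
      using e \<open>0 \<le> K\<close> q(2) err0 by (intro add_mono mult_left_mono) auto
    finally have main: "\<bar>T f z - f z * T (\<lambda>z. 1) z\<bar> \<le> e + e * korovkin_error T + 2 * K * korovkin_error T"
      by (simp add: algebra_simps)
    have "\<bar>f z * (T (\<lambda>z. 1) z - 1)\<bar> \<le> M * korovkin_error T"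
      unfolding abs_mult using M[of z] err0 by (intro mult_mono) auto
    with main show "\<bar>T f z - f z\<bar> \<le> e + (e + 2 * K + M) * korovkin_error T"
      unfolding distrib_right right_diff_distrib by linarith
  qed
  then show thesis
    by (rule that)
qed


section \<open>Power series means of positive operators\<close>

text \<open>If \<open>M\<close> bounds \<open>f\<close>, positivity bounds the image of
  \<open>f\<close> by \<open>M\<close> times the image of 1. The resulting majorant does not depend
  on \<open>z\<close>, as the M-test requires.\<close>

lemma double_summable_operator:
  assumes p: "\<And>m n. 0 \<le> p m n" and L: "\<And>m n. positive_linear_operator (L m n)"
    and rs: "0 < r" "0 < s"
    and sm: "double_summable (\<lambda>m n. sup_norm (L m n (\<lambda>z. 1)) * p m n * r ^ m * s ^ n)"
    and f: "f \<in> Cstar"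
  obtains b where "double_summable b" "\<And>m n z. \<bar>L m n f z * p m n * r ^ m * s ^ n\<bar> \<le> b m n"
proof -
  obtain M where M: "\<And>z. \<bar>f z\<bar> \<le> M"
    using Cstar_bounded[OF f] by blast
  then have "0 \<le> M"
    using order_trans[OF abs_ge_zero] by blast
  show thesis
  proof (rule that)
    show "double_summable (\<lambda>m n. M * (sup_norm (L m n (\<lambda>z. 1)) * p m n * r ^ m * s ^ n))"
      using double_sums_cmult[OF double_summable_sums[OF sm]] unfolding double_summable_def by blast
    fix m n z
    have "\<bar>L m n f z\<bar> \<le> L m n (\<lambda>w. M * 1) z"
      using M by (intro plo_abs_le[OF L] f Cstar_cmult Cstar_const) auto
    also have "\<dots> = M * L m n (\<lambda>w. 1) z"
      by (rule plo_cmult[OF L Cstar_const])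
    also have "\<dots> \<le> M * sup_norm (L m n (\<lambda>w. 1))"
      using abs_le_sup_norm[OF plo_Cstar[OF L Cstar_const], of m n 1 z] \<open>0 \<le> M\<close>
      by (intro mult_left_mono) auto
    finally have "\<bar>L m n f z\<bar> * (p m n * r ^ m * s ^ n)
        \<le> M * sup_norm (L m n (\<lambda>w. 1)) * (p m n * r ^ m * s ^ n)"
      using p rs by (intro mult_right_mono) auto
    then show "\<bar>L m n f z * p m n * r ^ m * s ^ n\<bar>
        \<le> M * (sup_norm (L m n (\<lambda>z. 1)) * p m n * r ^ m * s ^ n)"
      using p rs by (simp add: abs_mult mult_ac)
  qed
qed

lemma positive_linear_operator_Jp_mean:
  assumes p: "\<And>m n. 0 \<le> p m n" and L: "\<And>m n. positive_linear_operator (L m n)"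
    and rs: "0 < r" "0 < s"
    and ps: "double_summable (\<lambda>m n. p m n * r ^ m * s ^ n)"
    and sm: "double_summable (\<lambda>m n. sup_norm (L m n (\<lambda>z. 1)) * p m n * r ^ m * s ^ n)"
  shows "positive_linear_operator (\<lambda>f. Jp_mean p (\<lambda>m n. L m n f) r s)"
proof -
  define t where "t f z m n = L m n f z * p m n * r ^ m * s ^ n" for f z m n
  define S where "S f z = double_suminf (t f z)" for f z
  define c where "c = 1 / p_fun p r s"
  have mean: "Jp_mean p (\<lambda>m n. L m n f) r s = (\<lambda>z. c * S f z)" for f
    by (simp add: Jp_mean_def c_def S_def t_def[abs_def])
  \<comment> \<open>A nonnegative factor \<open>c\<close> preserves positivity; the convention that
    \<open>1 / 0\<close> is 0 fits this as well.\<close>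
  have "0 \<le> p_fun p r s"
    unfolding p_fun_def using p rs by (intro double_sums_nonneg[OF _ double_summable_sums[OF ps]]) auto
  then have c: "0 \<le> c"
    by (simp add: c_def)
  have sums: "double_sums (t f z) (S f z)" if f: "f \<in> Cstar" for f z
    unfolding S_def t_def[abs_def]
    by (rule double_summable_operator[OF p L rs sm f])
      (rule double_summable_sums[OF double_summable_comparison])
  have Cstar: "S f \<in> Cstar" if f: "f \<in> Cstar" for f
  proof -
    obtain b where b: "double_summable b" "\<And>m n z. \<bar>t f z m n\<bar> \<le> b m n"
      using double_summable_operator[OF p L rs sm f] unfolding t_def by metis
    have lim: "uniform_limit UNIV (\<lambda>q z. rect_sum (\<lambda>m n. t f z m n) q) (S f) (sequentially \<times>\<^sub>F sequentially)"
      using uniform_limit_rect_sum[of "\<lambda>m n z. t f z m n", OF b(2,1)] by (simp add: S_def[abs_def])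
    have "continuous_on UNIV (\<lambda>z. rect_sum (t f z) q)" for q
      using Cstar_continuous[OF plo_Cstar[OF L f]]
      by (cases q) (auto simp: rect_sum_def t_def intro!: continuous_intros)
    then have "continuous_on UNIV (S f)"
      by (intro uniform_limit_theorem[OF always_eventually lim prod_sequentially_nontrivial] allI)
    moreover have "L m n f (x, y) = L m n f (x + 2 * of_int k * pi, y)"
        "L m n f (x, y) = L m n f (x, y + 2 * of_int k * pi)" for m n x y k
      using plo_Cstar[OF L f, of m n] by (auto simp: Cstar_def)
    \<comment> \<open>Periodicity passes to the sum because the series at the two points have
      identical terms.\<close>
    then have "S f (x, y) = S f (x + 2 * of_int k * pi, y)"
        "S f (x, y) = S f (x, y + 2 * of_int k * pi)" for x y k
      unfolding S_def t_def[abs_def] by presburger+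
    ultimately show ?thesis
      by (auto simp: Cstar_def)
  qed
  have add: "S (\<lambda>z. f z + g z) z = S f z + S g z" if "f \<in> Cstar" "g \<in> Cstar" for f g z
  proof -
    have "t (\<lambda>z. f z + g z) z = (\<lambda>m n. t f z m n + t g z m n)"
      using plo_add[OF L that] by (auto simp: t_def[abs_def] algebra_simps)
    then show ?thesis
      using double_suminf_eqI[OF double_sums_add[OF sums[OF that(1)] sums[OF that(2)]]]
      by (simp add: S_def)
  qed
  have scale: "S (\<lambda>z. d * f z) z = d * S f z" if "f \<in> Cstar" for d f z
  proof -
    have "t (\<lambda>z. d * f z) z = (\<lambda>m n. d * t f z m n)"
      using plo_cmult[OF L that] by (auto simp: t_def[abs_def] algebra_simps)
    then show ?thesis
      using double_suminf_eqI[OF double_sums_cmult[OF sums[OF that]]] by (simp add: S_def)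
  qed
  have nonneg: "0 \<le> S f z" if "f \<in> Cstar" "\<And>z. 0 \<le> f z" for f z
    using p rs plo_nonneg[OF L that] by (intro double_sums_nonneg[OF _ sums[OF that(1)]]) (simp add: t_def)
  show ?thesis
    unfolding positive_linear_operator_def mean
    using Cstar add scale nonneg c by (auto intro!: Cstar_cmult simp: algebra_simps)
qed

section \<open>The equivalence for the power series method\<close>

theorem theorem2p1:
  fixes p :: "nat \<Rightarrow> nat \<Rightarrow> real"
    and L :: "nat \<Rightarrow> nat \<Rightarrow> (real \<times> real \<Rightarrow> real) \<Rightarrow> (real \<times> real \<Rightarrow> real)"
    and f\<^sub>0 f\<^sub>1 f\<^sub>2 f\<^sub>3 f\<^sub>4 :: "real \<times> real \<Rightarrow> real"
  assumes p_nonneg: "\<And>m n. 0 \<le> p m n"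
    and p_00: "0 < p 0 0"
    and p_diverges: "filterlim (rect_sum p) at_top (sequentially \<times>\<^sub>F sequentially)"
    and p_summable: "\<And>r s. r \<in> {0<..<1} \<Longrightarrow> s \<in> {0<..<1} \<Longrightarrow>
           double_summable (\<lambda>m n. p m n * r ^ m * s ^ n)"
    and f0: "f\<^sub>0 = (\<lambda>(x, y). 1)"
    and f1: "f\<^sub>1 = (\<lambda>(x, y). sin x)"
    and f2: "f\<^sub>2 = (\<lambda>(x, y). sin y)"
    and f3: "f\<^sub>3 = (\<lambda>(x, y). cos x)"
    and f4: "f\<^sub>4 = (\<lambda>(x, y). cos y)"
    and L_positive: "\<And>m n. positive_linear_operator (L m n)"
    and L_summable: "\<And>r s. r \<in> {0<..<1} \<Longrightarrow> s \<in> {0<..<1} \<Longrightarrow>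
           double_summable (\<lambda>m n. sup_norm (L m n f\<^sub>0) * p m n * r ^ m * s ^ n)"
  shows "(\<forall>f\<in>Cstar. Jp_converges p (\<lambda>m n. L m n f) f) \<longleftrightarrow>
         (\<forall>f\<in>{f\<^sub>0, f\<^sub>1, f\<^sub>2, f\<^sub>3, f\<^sub>4}. Jp_converges p (\<lambda>m n. L m n f) f)"
proof
  assume all: "\<forall>f\<in>Cstar. Jp_converges p (\<lambda>m n. L m n f) f"
  have "{f\<^sub>0, f\<^sub>1, f\<^sub>2, f\<^sub>3, f\<^sub>4} \<subseteq> Cstar"
    using Cstar_trig Cstar_const[of 1] by (simp add: f0 f1 f2 f3 f4 case_prod_beta')
  with all show "\<forall>f\<in>{f\<^sub>0, f\<^sub>1, f\<^sub>2, f\<^sub>3, f\<^sub>4}. Jp_converges p (\<lambda>m n. L m n f) f"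
    by blast
next
  assume test: "\<forall>f\<in>{f\<^sub>0, f\<^sub>1, f\<^sub>2, f\<^sub>3, f\<^sub>4}. Jp_converges p (\<lambda>m n. L m n f) f"
  let ?F = "at_left (1::real) \<times>\<^sub>F at_left (1::real)"
  define T where "T r s f = Jp_mean p (\<lambda>m n. L m n f) r s" for r s f
  have f_eq: "f\<^sub>0 = (\<lambda>z. 1)" "f\<^sub>1 = (\<lambda>z. sin (fst z))" "f\<^sub>2 = (\<lambda>z. sin (snd z))"
      "f\<^sub>3 = (\<lambda>z. cos (fst z))" "f\<^sub>4 = (\<lambda>z. cos (snd z))"
    by (auto simp: f0 f1 f2 f3 f4)
  have T: "positive_linear_operator (T r s)" if "r \<in> {0<..<1}" "s \<in> {0<..<1}" for r s
    using that positive_linear_operator_Jp_mean[OF p_nonneg L_positive _ _ p_summable[OF that]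
        L_summable[OF that, unfolded f_eq]]
    unfolding T_def[abs_def] by simp
  \<comment> \<open>Only for \<open>r\<close> and \<open>s\<close> in (0, 1) is \<open>T r s\<close>
    known to be a positive linear operator; near the limit point this always holds.\<close>
  have in_unit: "\<forall>\<^sub>F q in ?F. fst q \<in> {0<..<1} \<and> snd q \<in> {0<..<1}"
    by (intro eventually_prodI eventually_at_left_real) auto
  have test_lim: "((\<lambda>q. sup_norm (\<lambda>z. T (fst q) (snd q) f z - f z)) \<longlongrightarrow> 0) ?F"
    if "f \<in> {f\<^sub>0, f\<^sub>1, f\<^sub>2, f\<^sub>3, f\<^sub>4}" for f
    using test that unfolding Jp_converges_def T_def case_prod_beta' by blast
  have "((\<lambda>q. korovkin_error (T (fst q) (snd q))) \<longlongrightarrow> 0 + 0 + 0 + 0 + 0) ?F"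
    unfolding korovkin_error_def
    using test_lim[of "f\<^sub>0"] test_lim[of "f\<^sub>1"] test_lim[of "f\<^sub>2"] test_lim[of "f\<^sub>3"] test_lim[of "f\<^sub>4"]
    by (intro tendsto_add) (simp_all add: f_eq)
  then have err: "((\<lambda>q. korovkin_error (T (fst q) (snd q))) \<longlongrightarrow> 0) ?F"
    by simp
  show "\<forall>f\<in>Cstar. Jp_converges p (\<lambda>m n. L m n f) f"
  proof
    fix f assume f: "f \<in> Cstar"
    have lim: "((\<lambda>q. sup_norm (\<lambda>z. T (fst q) (snd q) f z - f z)) \<longlongrightarrow> 0) ?F"
    proof (rule tendstoI)
      fix e :: real assume e: "0 < e"
      \<comment> \<open>\<open>K\<close> is fixed before \<open>r\<close> and \<open>s\<close> vary,
        so \<open>K\<close> times the error tends to 0 and the bound tends to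
        \<open>e / 2\<close>.\<close>
      obtain K where K: "\<And>T. positive_linear_operator T \<Longrightarrow>
          sup_norm (\<lambda>z. T f z - f z) \<le> e / 2 + K * korovkin_error T"
        using korovkin_quantitative[OF f, of "e / 2"] e by auto
      have "((\<lambda>q. e / 2 + K * korovkin_error (T (fst q) (snd q))) \<longlongrightarrow> e / 2 + K * 0) ?F"
        by (intro tendsto_intros err)
      from order_tendstoD(2)[OF this, of e] e
      have "\<forall>\<^sub>F q in ?F. e / 2 + K * korovkin_error (T (fst q) (snd q)) < e"
        by simp
      with in_unit show "\<forall>\<^sub>F q in ?F. dist (sup_norm (\<lambda>z. T (fst q) (snd q) f z - f z)) 0 < e"
      proof eventually_elim
        case (elim q)
        then have "positive_linear_operator (T (fst q) (snd q))"
          by (intro T) auto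
        moreover from this have "0 \<le> sup_norm (\<lambda>z. T (fst q) (snd q) f z - f z)"
          by (rule sup_norm_nonneg[OF Cstar_diff[OF plo_Cstar[OF _ f] f]])
        ultimately show ?case
          using K[of "T (fst q) (snd q)"] elim by (simp add: dist_real_def)
      qed
    qed
    \<comment> \<open>Besides the limit, convergence in the sense of \<open>Jp_converges\<close>
      demands that the series converge and that the means lie in \<open>Cstar\<close>.\<close>
    have summable: "double_summable (\<lambda>m n. L m n f z * p m n * r ^ m * s ^ n)"
      if rs: "r \<in> {0<..<1}" "s \<in> {0<..<1}" for r s z
    proof -
      have "0 < r" "0 < s"
        using rs by auto
      then show ?thesis
        by (rule double_summable_operator[OF p_nonneg L_positive _ _ L_summable[OF rs, unfolded f_eq] f])
          (rule double_summable_comparison)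
    qed
    have "Jp_mean p (\<lambda>m n. L m n f) r s \<in> Cstar" if "r \<in> {0<..<1}" "s \<in> {0<..<1}" for r s
      using plo_Cstar[OF T[OF that] f] by (simp add: T_def)
    then show "Jp_converges p (\<lambda>m n. L m n f) f"
      unfolding Jp_converges_def using lim summable by (auto simp: T_def case_prod_beta')
  qed
qed

end
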